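(* Let $H\in\mathbb{R}^{d\times d}$ be symmetric with all its singular values in $[\nu,L_G]$ for some $0<\nu\le L_G$. Consider vectors $g,\xi\in\mathbb{R}^d$ and a radius $\Delta>0$. Assume $\|\xi\|\le\Delta/4$ and $\langle H\xi,g\rangle\ge0$. Run tCG-bg$(H,g,\Delta,\xi)$ (see context) with output $(u,\mathrm{stop},T)$. If stop $=$ boundary, then $$m(v^{(0)})-m(u)\ge\frac{\nu^2\Delta^2}{32L_G},$$ where $m(v)=\langle g,v\rangle+\frac12\langle v,Hv\rangle$ and $v^{(0)}=\xi$.
   Context: Notation: $\|\cdot\|$ is the Euclidean norm. Boundary gradient step BG$(H,g,\Delta,v)$: let $r=-(Hv+g)$. If $\langle r,Hr\rangle\le0$ or $\|v+\bar\alpha r\|\ge\Delta$ with $\bar\alpha=\|r\|^2/\langle r,Hr\rangle$, output $u=v+s'r$ with $s'\ge0$ such that $\|u\|=\Delta$ (if $r=0$, output $u=v$); otherwise output $u=v+\bar\alpha r$. Algorithm tCG-bg$(H,g,\Delta,\xi)$ (parameters $\omega_1\in(0,1)$, $\omega_2>0$; $H$ symmetric $d\times d$, $g,\xi\in\mathbb{R}^d$, $\Delta>0$, $\|\xi\|\le\Delta/4$): set $v^{(0)}=\xi$, $r^{(0)}=-(Hv^{(0)}+g)$, $p^{(0)}=r^{(0)}$. If $r^{(0)}=0$, output $u=v^{(0)}$, stop $=$ residual, $T=0$. For $t=1,2,\dots$: let $\alpha^{(t)}=\|r^{(t-1)}\|^2/\langle p^{(t-1)},Hp^{(t-1)}\rangle$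 and $v_+^{(t-1)}=v^{(t-1)}+\alpha^{(t)}p^{(t-1)}$. If $\langle p^{(t-1)},Hp^{(t-1)}\rangle\le0$ or $\|v_+^{(t-1)}\|\ge\Delta/2$, set $v^{(t)}=v^{(t-1)}+sp^{(t-1)}$ with $s\ge0$ such that $\|v^{(t)}\|=\Delta/2$, and output $u=$ BG$(H,g,\Delta,v^{(t)})$, stop $=$ boundary, $T=t$. Otherwise set $v^{(t)}=v_+^{(t-1)}$ and $r^{(t)}=r^{(t-1)}-\alpha^{(t)}Hp^{(t-1)}$; if $\|r^{(t)}\|\le\min(\omega_1\|g\|,\omega_2\|g\|^2)$, output $u=v^{(t)}$, stop $=$ residual, $T=t$; else set $\beta^{(t)}=\|r^{(t)}\|^2/\|r^{(t-1)}\|^2$, $p^{(t)}=r^{(t)}+\beta^{(t)}p^{(t-1)}$ and continue. *)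

theory Defs
  imports "HOL-Analysis.Analysis"
begin

text \<open>
  The singular values of a square matrix are the square roots of the eigenvalues of
  \<open>transpose A ** A\<close>; these eigenvalues are nonnegative.
\<close>

definition singular_values :: "real^'d^'d \<Rightarrow> real set" where
  "singular_values A =
     {sqrt l | l. \<exists>x. x \<noteq> 0 \<and> (transpose A ** A) *v x = l *\<^sub>R x}"

definition quad_model :: "real^'d^'d \<Rightarrow> real^'d \<Rightarrow> real^'d \<Rightarrow> real" where
  "quad_model H g v = g \<bullet> v + 1/2 * (v \<bullet> (H *v v))"

text \<open>
  The boundary gradient step and the algorithm are given as relations between inputs and outputs,
  because step lengths are specified only by the condition that the new point has a prescribed norm.
  If a curvature \<open>x \<bullet> (H *v x)\<close> is \<open>0\<close>, the quotient by it is the arbitrary value \<open>0\<close>;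
  it plays no role, since the nonpositive-curvature test then already succeeds.
\<close>

definition boundary_gradient_step ::
  "real^'d^'d \<Rightarrow> real^'d \<Rightarrow> real \<Rightarrow> real^'d \<Rightarrow> real^'d \<Rightarrow> bool" where
  "boundary_gradient_step H g \<Delta> v u \<longleftrightarrow>
     (let r = - (H *v v + g);
          \<alpha> = (norm r)\<^sup>2 / (r \<bullet> (H *v r))
      in if r \<bullet> (H *v r) \<le> 0 \<or> norm (v + \<alpha> *\<^sub>R r) \<ge> \<Delta>
         then (if r = 0 then u = v
               else \<exists>s\<ge>0. u = v + s *\<^sub>R r \<and> norm u = \<Delta>)
         else u = v + \<alpha> *\<^sub>R r)"

datatype stop_reason = Boundary | Residual

text \<open>With \<open>\<rho> = r\<^bsup>(t-1)\<^esup>\<close> and \<open>p = p\<^bsup>(t-1)\<^esup>\<close>, this is \<open>\<alpha>\<^bsup>(t)\<^esup>\<close>.\<close>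

definition cg_step_length :: "real^'d^'d \<Rightarrow> real^'d \<Rightarrow> real^'d \<Rightarrow> real" where
  "cg_step_length H \<rho> p = (norm \<rho>)\<^sup>2 / (p \<bullet> (H *v p))"

definition cg_leaves ::
  "real^'d^'d \<Rightarrow> real \<Rightarrow> real^'d \<Rightarrow> real^'d \<Rightarrow> real^'d \<Rightarrow> bool" where
  "cg_leaves H \<Delta> v \<rho> p \<longleftrightarrow>
     p \<bullet> (H *v p) \<le> 0 \<or> norm (v + cg_step_length H \<rho> p *\<^sub>R p) \<ge> \<Delta> / 2"

text \<open>
  \<open>tCG_bg_state \<omega>1 \<omega>2 H g \<Delta> \<xi> t v \<rho> p\<close>: the run has not stopped during iterations
  \<open>1, \<dots>, t\<close> (nor at initialization), and \<open>v\<close>, \<open>\<rho>\<close>, \<open>p\<close> are the vectors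
  \<open>v\<^bsup>(t)\<^esup>\<close>, \<open>r\<^bsup>(t)\<^esup>\<close>, \<open>p\<^bsup>(t)\<^esup>\<close>.
\<close>

inductive tCG_bg_state ::
  "real \<Rightarrow> real \<Rightarrow> real^'d^'d \<Rightarrow> real^'d \<Rightarrow> real \<Rightarrow> real^'d \<Rightarrow>
   nat \<Rightarrow> real^'d \<Rightarrow> real^'d \<Rightarrow> real^'d \<Rightarrow> bool"
  for \<omega>1 \<omega>2 H g \<Delta> \<xi> where
  init: "\<lbrakk>\<rho> = - (H *v \<xi> + g); \<rho> \<noteq> 0\<rbrakk> \<Longrightarrow> tCG_bg_state \<omega>1 \<omega>2 H g \<Delta> \<xi> 0 \<xi> \<rho> \<rho>"
| step: "\<lbrakk>tCG_bg_state \<omega>1 \<omega>2 H g \<Delta> \<xi> t v \<rho> p;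
          \<not> cg_leaves H \<Delta> v \<rho> p;
          \<alpha> = cg_step_length H \<rho> p;
          v' = v + \<alpha> *\<^sub>R p;
          \<rho>' = \<rho> - \<alpha> *\<^sub>R (H *v p);
          \<not> norm \<rho>' \<le> min (\<omega>1 * norm g) (\<omega>2 * (norm g)\<^sup>2);
          \<beta> = (norm \<rho>')\<^sup>2 / (norm \<rho>)\<^sup>2;
          p' = \<rho>' + \<beta> *\<^sub>R p\<rbrakk>
         \<Longrightarrow> tCG_bg_state \<omega>1 \<omega>2 H g \<Delta> \<xi> (Suc t) v' \<rho>' p'"

text \<open>
  \<open>tCG_bg \<omega>1 \<omega>2 H g \<Delta> \<xi> u stop T\<close>: the algorithm run on \<open>(H, g, \<Delta>, \<xi>)\<close> terminates
  with output \<open>(u, stop, T)\<close>.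
\<close>

inductive tCG_bg ::
  "real \<Rightarrow> real \<Rightarrow> real^'d^'d \<Rightarrow> real^'d \<Rightarrow> real \<Rightarrow> real^'d \<Rightarrow>
   real^'d \<Rightarrow> stop_reason \<Rightarrow> nat \<Rightarrow> bool"
  for \<omega>1 \<omega>2 H g \<Delta> \<xi> where
  zero_residual: "- (H *v \<xi> + g) = 0 \<Longrightarrow> tCG_bg \<omega>1 \<omega>2 H g \<Delta> \<xi> \<xi> Residual 0"
| boundary: "\<lbrakk>tCG_bg_state \<omega>1 \<omega>2 H g \<Delta> \<xi> t v \<rho> p;
              cg_leaves H \<Delta> v \<rho> p;
              s \<ge> 0;
              v' = v + s *\<^sub>R p;
              norm v' = \<Delta> / 2;
              boundary_gradient_step H g \<Delta> v' u\<rbrakk>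
             \<Longrightarrow> tCG_bg \<omega>1 \<omega>2 H g \<Delta> \<xi> u Boundary (Suc t)"
| small_residual: "\<lbrakk>tCG_bg_state \<omega>1 \<omega>2 H g \<Delta> \<xi> t v \<rho> p;
              \<not> cg_leaves H \<Delta> v \<rho> p;
              \<alpha> = cg_step_length H \<rho> p;
              v' = v + \<alpha> *\<^sub>R p;
              \<rho>' = \<rho> - \<alpha> *\<^sub>R (H *v p);
              norm \<rho>' \<le> min (\<omega>1 * norm g) (\<omega>2 * (norm g)\<^sup>2)\<rbrakk>
             \<Longrightarrow> tCG_bg \<omega>1 \<omega>2 H g \<Delta> \<xi> v' Residual (Suc t)"

end

theory Submission
  imports Defs
begin

text \<open>
  Write \<open>r\<close> for the residual \<open>- (H v + g)\<close>. Every step of the algorithm, truncated or not, follows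
  a direction \<open>p\<close> with \<open>r \<bullet> p = \<parallel>r\<parallel>\<^sup>2\<close> and does not overshoot the minimum of the model along it, so
  the model never increases. Since \<open>\<langle>H\<xi>, g\<rangle> \<ge> 0\<close>, the initial residual is at least as long as \<open>g\<close>.
  If \<open>\<parallel>g\<parallel> \<ge> \<nu>\<Delta>/4\<close>, the first step alone gives the decrease. If \<open>\<parallel>g\<parallel> \<le> \<nu>\<Delta>/4\<close>,
  then at the point \<open>v\<close> with \<open>\<parallel>v\<parallel> = \<Delta>/2\<close> the residual is at least
  \<open>\<nu>\<Delta>/2 - \<nu>\<Delta>/4 = \<nu>\<Delta>/4\<close>, and the boundary gradient step gives it.
\<close>

section \<open>Singular values as bounds on the stretching of vectors\<close>

lemma symmetric_inner_swap:
  fixes A :: "real^'n^'n"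
  assumes "transpose A = A"
  shows "x \<bullet> (A *v y) = y \<bullet> (A *v x)"
  by (metis assms dot_lmul_matrix inner_commute transpose_matrix_vector)

text \<open>If \<open>w = B *v x\<close> were nonzero, moving from \<open>x\<close> along
  \<open>- w\<close> would change the form at first order by
  \<open>- 2 * t * (w \<bullet> w)\<close> and push it below 0.\<close>

lemma psd_kernel:
  fixes B :: "real^'n^'n"
  assumes sym: "transpose B = B" and psd: "\<And>y. 0 \<le> y \<bullet> (B *v y)"
    and zero: "x \<bullet> (B *v x) = 0"
  shows "B *v x = 0"
proof (rule ccontr)
  define w where "w = B *v x"
  define c where "c = w \<bullet> (B *v w)"
  assume "B *v x \<noteq> 0"
  then have pos: "w \<bullet> w > 0" by (simp add: w_def)
  have c: "c \<ge> 0" unfolding c_def by (rule psd)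
  \<comment> \<open>Small enough that the quadratic term is at most half the linear one;
    \<open>+ 1\<close> keeps the denominator positive when \<open>c = 0\<close>.\<close>
  define t where "t = (w \<bullet> w) / (c + 1)"
  have t: "t > 0" and tc: "t * c \<le> w \<bullet> w"
    using pos c by (auto simp: t_def field_simps)
  have "(x - t *\<^sub>R w) \<bullet> (B *v (x - t *\<^sub>R w))
      = x \<bullet> (B *v x) - t * (x \<bullet> (B *v w)) - t * (w \<bullet> (B *v x)) + t * t * c"
    by (simp add: matrix_vector_mult_diff_distrib matrix_vector_mult_scaleR inner_diff_left
        inner_diff_right c_def algebra_simps)
  also have "\<dots> = t * (t * c - 2 * (w \<bullet> w))"
    using zero symmetric_inner_swap[OF sym, of x w] by (simp add: w_def algebra_simps)
  also have "\<dots> < 0"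
    using t tc pos by (intro mult_pos_neg) linarith+
  finally show False using psd[of "x - t *\<^sub>R w"] by simp
qed

text \<open>With \<open>l\<close> the extremal value, \<open>A - mat l\<close> (minimum) or
  \<open>mat l - A\<close> (maximum) is positive semidefinite and its form vanishes at
  \<open>x\<close>, so \<open>psd_kernel\<close> applies.\<close>

lemma rayleigh_extremum_eigenvector:
  fixes A :: "real^'n^'n"
  assumes sym: "transpose A = A" and unit: "norm x = 1"
    and extr: "(\<forall>y. norm y = 1 \<longrightarrow> x \<bullet> (A *v x) \<le> y \<bullet> (A *v y)) \<or>
      (\<forall>y. norm y = 1 \<longrightarrow> y \<bullet> (A *v y) \<le> x \<bullet> (A *v x))"
  shows "A *v x = (x \<bullet> (A *v x)) *\<^sub>R x"
proof -
  define l where "l = x \<bullet> (A *v x)"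
  have scale: "y \<bullet> (A *v y) = (norm y)\<^sup>2 * (sgn y \<bullet> (A *v sgn y))" for y
    by (cases "y = 0")
      (auto simp: sgn_div_norm matrix_vector_mult_scaleR power2_eq_square field_simps)
  have sub: "(A - mat l) *v y = A *v y - l *\<^sub>R y" "(mat l - A) *v y = l *\<^sub>R y - A *v y" for y
  proof -
    have "mat l *v y = l *\<^sub>R y"
      by (simp add: vec_eq_iff matrix_vector_mult_def mat_def if_distrib[of "\<lambda>c. c * _"] cong: if_cong)
    then show "(A - mat l) *v y = A *v y - l *\<^sub>R y" "(mat l - A) *v y = l *\<^sub>R y - A *v y"
      by (simp_all add: matrix_vector_mult_diff_rdistrib)
  qed
  have symd: "transpose (A - mat l) = A - mat l" "transpose (mat l - A) = mat l - A"
    using sym by (auto simp: transpose_def vec_eq_iff mat_def)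
  have xx: "x \<bullet> x = 1" using unit by (simp add: norm_eq_1)
  from extr show ?thesis
  proof
    assume min: "\<forall>y. norm y = 1 \<longrightarrow> x \<bullet> (A *v x) \<le> y \<bullet> (A *v y)"
    have "0 \<le> y \<bullet> ((A - mat l) *v y)" for y
    proof (cases "y = 0")
      case False
      then have "(norm y)\<^sup>2 * l \<le> (norm y)\<^sup>2 * (sgn y \<bullet> (A *v sgn y))"
        unfolding l_def using min by (intro mult_left_mono) (auto simp: norm_sgn)
      then show ?thesis
        unfolding scale[of y, symmetric] by (simp add: sub inner_diff_right power2_norm_eq_inner mult.commute)
    qed simp
    then have "(A - mat l) *v x = 0"
      by (intro psd_kernel symd) (auto simp: sub inner_diff_right xx simp flip: l_def)
    then show ?thesis by (simp add: sub xx flip: l_def)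
  next
    assume max: "\<forall>y. norm y = 1 \<longrightarrow> y \<bullet> (A *v y) \<le> x \<bullet> (A *v x)"
    have "0 \<le> y \<bullet> ((mat l - A) *v y)" for y
    proof (cases "y = 0")
      case False
      then have "(norm y)\<^sup>2 * (sgn y \<bullet> (A *v sgn y)) \<le> (norm y)\<^sup>2 * l"
        unfolding l_def using max by (intro mult_left_mono) (auto simp: norm_sgn)
      then show ?thesis
        unfolding scale[of y, symmetric] by (simp add: sub inner_diff_right power2_norm_eq_inner mult.commute)
    qed simp
    then have "(mat l - A) *v x = 0"
      by (intro psd_kernel symd) (auto simp: sub inner_diff_right xx simp flip: l_def)
    then show ?thesis by (simp add: sub xx flip: l_def)
  qed
qed

lemma norm_matrix_vector_sq:
  fixes A :: "real^'n^'m"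
  shows "(norm (A *v x))\<^sup>2 = x \<bullet> ((transpose A ** A) *v x)"
  by (metis dot_lmul_matrix inner_commute matrix_vector_mul_assoc power2_norm_eq_inner
      transpose_matrix_vector)

text \<open>By compactness \<open>norm (A *v z)\<close> attains its extrema on the unit sphere. An
  extremal \<open>z\<close> is an eigenvector of \<open>transpose A ** A\<close> with eigenvalue
  \<open>(norm (A *v z))\<^sup>2\<close>, so both extrema are singular values; homogeneity does the
  rest.\<close>

lemma singular_values_norm_bounds:
  fixes A :: "real^'d^'d"
  assumes sing: "singular_values A \<subseteq> {a..b}"
  shows "a * norm x \<le> norm (A *v x)" and "norm (A *v x) \<le> b * norm x"
proof -
  let ?S = "sphere (0::real^'d) 1"
  have cont: "continuous_on ?S (\<lambda>x. norm (A *v x))"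
    by (intro continuous_intros matrix_vector_mult_linear_continuous_on)
  have ne: "?S \<noteq> {}" by simp
  have sv: "norm (A *v z) \<in> {a..b}"
    if z: "norm z = 1" and ex: "(\<forall>y\<in>?S. norm (A *v z) \<le> norm (A *v y)) \<or>
      (\<forall>y\<in>?S. norm (A *v y) \<le> norm (A *v z))" for z
  proof -
    have "(transpose A ** A) *v z = (z \<bullet> ((transpose A ** A) *v z)) *\<^sub>R z"
    proof (rule rayleigh_extremum_eigenvector)
      show "transpose (transpose A ** A) = transpose A ** A"
        by (simp add: matrix_transpose_mul)
      show "(\<forall>y. norm y = 1 \<longrightarrow> z \<bullet> ((transpose A ** A) *v z) \<le> y \<bullet> ((transpose A ** A) *v y)) \<or>
        (\<forall>y. norm y = 1 \<longrightarrow> y \<bullet> ((transpose A ** A) *v y) \<le> z \<bullet> ((transpose A ** A) *v z))"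
        using ex by (auto simp flip: norm_matrix_vector_sq intro!: power_mono)
    qed (rule z)
    then have "(transpose A ** A) *v z = (norm (A *v z))\<^sup>2 *\<^sub>R z"
      by (simp only: norm_matrix_vector_sq)
    moreover have "z \<noteq> 0" using z by auto
    moreover have "norm (A *v z) = sqrt ((norm (A *v z))\<^sup>2)" by simp
    ultimately have "norm (A *v z) \<in> singular_values A"
      unfolding singular_values_def by blast
    then show ?thesis using sing by blast
  qed
  obtain z where "z \<in> ?S" "\<forall>y\<in>?S. norm (A *v z) \<le> norm (A *v y)"
    using continuous_attains_inf[OF compact_sphere ne cont] by blast
  with sv[of z] have lo: "a \<le> norm (A *v y)" if "norm y = 1" for y
    using that by force
  obtain z' where "z' \<in> ?S" "\<forall>y\<in>?S. norm (A *v y) \<le> norm (A *v z')"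
    using continuous_attains_sup[OF compact_sphere ne cont] by blast
  with sv[of z'] have hi: "norm (A *v y) \<le> b" if "norm y = 1" for y
    using that by force
  have "norm (A *v x) = norm x * norm (A *v sgn x)"
    by (cases "x = 0") (auto simp: sgn_div_norm matrix_vector_mult_scaleR)
  then show "a * norm x \<le> norm (A *v x)" "norm (A *v x) \<le> b * norm x"
    using lo[of "sgn x"] hi[of "sgn x"]
    by (cases "x = 0"; simp add: norm_sgn mult.commute[of _ "norm x"] mult_left_mono)+
qed

section \<open>Decrease of the model along one step\<close>

lemma quad_model_along:
  fixes H :: "real^'d^'d"
  assumes sym: "transpose H = H"
  shows "quad_model H g v - quad_model H g (v + s *\<^sub>R p)
    = s * (- (H *v v + g) \<bullet> p) - s\<^sup>2 / 2 * (p \<bullet> (H *v p))"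
proof -
  have "v \<bullet> (H *v p) = p \<bullet> (H *v v)" by (rule symmetric_inner_swap[OF sym])
  then show ?thesis
    by (simp add: quad_model_def matrix_vector_right_distrib matrix_vector_mult_scaleR
        inner_add_left inner_add_right inner_diff_right inner_commute power2_eq_square field_simps)
qed

text \<open>Because \<open>r \<bullet> p = (norm r)\<^sup>2\<close>, this step length is the exact
  minimizer along \<open>p\<close>. The hypothesis covers gradient and conjugate gradient directions
  alike.\<close>

lemma quad_model_full_step:
  fixes H :: "real^'d^'d"
  assumes sym: "transpose H = H" and r: "r = - (H *v v + g)" and rp: "r \<bullet> p = (norm r)\<^sup>2"
    and pos: "p \<bullet> (H *v p) > 0"
  shows "quad_model H g v - quad_model H g (v + ((norm r)\<^sup>2 / (p \<bullet> (H *v p))) *\<^sub>R p)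
    = (norm r)^4 / (2 * (p \<bullet> (H *v p)))"
  unfolding quad_model_along[OF sym] r[symmetric] rp using pos
  by (simp add: field_simps power2_eq_square power4_eq_xxxx)

text \<open>It suffices that \<open>s * c \<le> (norm r)\<^sup>2\<close>, for the curvature term
  then costs at most half the linear gain. When \<open>c\<close> is positive this says that
  \<open>s\<close> does not exceed the full step length.\<close>

lemma quad_model_truncated_step:
  fixes H :: "real^'d^'d"
  assumes sym: "transpose H = H" and r: "r = - (H *v v + g)" and rp: "r \<bullet> p = (norm r)\<^sup>2"
    and v: "norm v < R" and s: "s \<ge> 0" and end_point: "norm (v + s *\<^sub>R p) = R"
    and leave: "p \<bullet> (H *v p) \<le> 0 \<or> norm (v + ((norm r)\<^sup>2 / (p \<bullet> (H *v p))) *\<^sub>R p) \<ge> R"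
  shows "quad_model H g v - quad_model H g (v + s *\<^sub>R p) \<ge> s * (norm r)\<^sup>2 / 2"
proof -
  define c where "c = p \<bullet> (H *v p)"
  have "s * c \<le> (norm r)\<^sup>2"
  proof (cases "c \<le> 0")
    case True
    then show ?thesis using s
      by (meson mult_nonneg_nonpos order_trans zero_le_power2)
  next
    case False
    define a where "a = (norm r)\<^sup>2 / c"
    have a: "a \<ge> 0" using False by (simp add: a_def)
    have "s \<le> a"
    proof (rule ccontr)
      assume "\<not> s \<le> a"
      then have as: "a < s" by simp
      \<comment> \<open>the full step would end strictly between \<open>v\<close> and the end point, inside the ball\<close>
      have "v + a *\<^sub>R p = (1 - a / s) *\<^sub>R v + (a / s) *\<^sub>R (v + s *\<^sub>R p)"
        using as a by (simp add: algebra_simps)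
      then have "norm (v + a *\<^sub>R p) \<le> \<bar>1 - a / s\<bar> * norm v + \<bar>a / s\<bar> * R"
        by (metis end_point norm_scaleR norm_triangle_ineq)
      also have "\<dots> = (1 - a / s) * norm v + (a / s) * R"
        using as a by simp
      also have "\<dots> < (1 - a / s) * R + (a / s) * R"
        using as a v by (intro add_strict_right_mono mult_strict_left_mono) auto
      also have "\<dots> = R" by (simp add: algebra_simps)
      finally show False using leave False by (simp add: a_def c_def)
    qed
    then show ?thesis using False by (simp add: a_def field_simps)
  qed
  then have "s * (s * c) \<le> s * (norm r)\<^sup>2"
    using s by (intro mult_left_mono)
  then show ?thesis
    unfolding quad_model_along[OF sym] r[symmetric] rp c_def by (simp add: power2_eq_square)
qed

lemma quad_model_full_gradient_step:
  fixes H :: "real^'d^'d"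
  assumes sym: "transpose H = H" and r: "r = - (H *v v + g)"
    and upper: "\<And>x. x \<bullet> (H *v x) \<le> L * (norm x)\<^sup>2" and pos: "r \<bullet> (H *v r) > 0"
  shows "quad_model H g v - quad_model H g (v + ((norm r)\<^sup>2 / (r \<bullet> (H *v r))) *\<^sub>R r)
    \<ge> (norm r)\<^sup>2 / (2 * L)"
proof -
  have n: "(norm r)\<^sup>2 > 0" using pos by auto
  have le: "r \<bullet> (H *v r) \<le> L * (norm r)\<^sup>2" by (rule upper)
  \<comment> \<open>Positivity of \<open>L\<close> is not assumed; it follows from the positive
    curvature along \<open>r\<close>.\<close>
  then have L: "L > 0" using pos n by (smt (verit) zero_less_mult_pos2)
  have "(norm r)\<^sup>2 / (2 * L) = (norm r)^4 / (2 * (L * (norm r)\<^sup>2))"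
    using n by (simp add: power2_eq_square power4_eq_xxxx)
  also have "\<dots> \<le> (norm r)^4 / (2 * (r \<bullet> (H *v r)))"
    using pos le L n by (intro divide_left_mono) auto
  finally show ?thesis
    by (simp only: quad_model_full_step[OF sym r power2_norm_eq_inner[symmetric] pos])
qed

text \<open>The step has to cross the gap from \<open>norm v\<close> to \<open>R\<close>, which
  bounds \<open>s * norm r\<close> from below.\<close>

lemma quad_model_truncated_gradient_step:
  fixes H :: "real^'d^'d"
  assumes sym: "transpose H = H" and r: "r = - (H *v v + g)"
    and v: "norm v < R" and s: "s \<ge> 0" and end_point: "norm (v + s *\<^sub>R r) = R"
    and leave: "r \<bullet> (H *v r) \<le> 0 \<or> norm (v + ((norm r)\<^sup>2 / (r \<bullet> (H *v r))) *\<^sub>R r) \<ge> R"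
  shows "quad_model H g v - quad_model H g (v + s *\<^sub>R r) \<ge> (R - norm v) * norm r / 2"
proof -
  have "R - norm v \<le> s * norm r"
    using norm_triangle_ineq[of v "s *\<^sub>R r"] s end_point by simp
  then have "(R - norm v) * norm r / 2 \<le> s * (norm r)\<^sup>2 / 2"
    using mult_right_mono[of "R - norm v" "s * norm r" "norm r"]
    by (simp add: power2_eq_square mult.assoc)
  also have "\<dots> \<le> quad_model H g v - quad_model H g (v + s *\<^sub>R r)"
    by (intro quad_model_truncated_step[OF sym r _ v s end_point leave])
      (simp add: power2_norm_eq_inner)
  finally show ?thesis .
qed

lemma boundary_gradient_step_decrease:
  fixes H :: "real^'d^'d"
  assumes sym: "transpose H = H" and r: "r = - (H *v v + g)"
    and upper: "\<And>x. x \<bullet> (H *v x) \<le> L * (norm x)\<^sup>2"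
    and v: "norm v < \<Delta>" and bg: "boundary_gradient_step H g \<Delta> v u"
  shows "quad_model H g v - quad_model H g u
    \<ge> min ((\<Delta> - norm v) * norm r / 2) ((norm r)\<^sup>2 / (2 * L))"
proof -
  let ?a = "(norm r)\<^sup>2 / (r \<bullet> (H *v r))"
  let ?leave = "r \<bullet> (H *v r) \<le> 0 \<or> norm (v + ?a *\<^sub>R r) \<ge> \<Delta>"
  have step: "if ?leave then (if r = 0 then u = v else \<exists>s\<ge>0. u = v + s *\<^sub>R r \<and> norm u = \<Delta>)
    else u = v + ?a *\<^sub>R r"
    using bg by (simp add: boundary_gradient_step_def Let_def r)
  show ?thesis
  proof (cases ?leave)
    case leave: True
    show ?thesis
    proof (cases "r = 0")
      case True
      \<comment> \<open>For \<open>r = 0\<close> both entries of the minimum vanish.\<close>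
      then show ?thesis using step by simp
    next
      case False
      with step leave obtain s where s: "s \<ge> 0" "u = v + s *\<^sub>R r" "norm u = \<Delta>" by auto
      then show ?thesis
        using quad_model_truncated_gradient_step[OF sym r v, of s] leave by auto
    qed
  next
    case False
    then have "u = v + ?a *\<^sub>R r" using step by (simp only: if_False)
    then show ?thesis
      using quad_model_full_gradient_step[OF sym r upper] False by auto
  qed
qed

section \<open>Invariant of the iteration and the final estimate\<close>

text \<open>The disjunction separates the starting state from those that have already banked the
  decrease of the first full gradient step, which later steps cannot undo.\<close>

lemma tCG_bg_state_invariant:
  fixes H :: "real^'d^'d"
  assumes run: "tCG_bg_state \<omega>1 \<omega>2 H g \<Delta> \<xi> t v \<rho> p"
    and sym: "transpose H = H" and upper: "\<And>x. x \<bullet> (H *v x) \<le> L * (norm x)\<^sup>2"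
    and start: "norm \<xi> < \<Delta> / 2"
  shows "\<rho> = - (H *v v + g) \<and> \<rho> \<bullet> p = (norm \<rho>)\<^sup>2 \<and> norm v < \<Delta> / 2 \<and>
    (v = \<xi> \<and> p = \<rho> \<or>
      quad_model H g \<xi> - quad_model H g v \<ge> (norm (H *v \<xi> + g))\<^sup>2 / (2 * L))"
  using run
proof (induction rule: tCG_bg_state.induct)
  case (init \<rho>)
  then show ?case using start by (simp add: power2_norm_eq_inner)
next
  case (step t v \<rho> p \<alpha> v' \<rho>' \<beta> p')
  have r: "\<rho> = - (H *v v + g)" and rp: "\<rho> \<bullet> p = (norm \<rho>)\<^sup>2" using step.IH by auto
  have pos: "p \<bullet> (H *v p) > 0" and small: "norm (v + \<alpha> *\<^sub>R p) < \<Delta> / 2"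
    using step.hyps by (auto simp: cg_leaves_def)
  have \<alpha>: "\<alpha> = (norm \<rho>)\<^sup>2 / (p \<bullet> (H *v p))"
    using step.hyps by (simp add: cg_step_length_def)
  have r': "\<rho>' = - (H *v v' + g)"
    using step.hyps r
    by (simp add: matrix_vector_right_distrib matrix_vector_mult_scaleR algebra_simps)
  \<comment> \<open>Exact minimization makes the new residual orthogonal to the old direction, so
    the \<open>\<beta>\<close> term of \<open>p'\<close> drops out of
    \<open>\<rho>' \<bullet> p'\<close>.\<close>
  have "\<rho>' \<bullet> p = (norm \<rho>)\<^sup>2 - \<alpha> * (p \<bullet> (H *v p))"
    using step.hyps rp by (simp add: inner_diff_left inner_commute[of "H *v p" p])
  also have "\<dots> = 0" using pos by (simp add: \<alpha>)
  finally have rp': "\<rho>' \<bullet> p' = (norm \<rho>')\<^sup>2"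
    using step.hyps by (simp add: inner_add_right power2_norm_eq_inner)
  have "quad_model H g \<xi> - quad_model H g v' \<ge> (norm (H *v \<xi> + g))\<^sup>2 / (2 * L)"
  proof (cases "v = \<xi> \<and> p = \<rho>")
    case True
    then show ?thesis
      using quad_model_full_gradient_step[OF sym r upper] pos \<alpha> step.hyps r
      by (metis norm_minus_cancel)
  next
    case False
    have "quad_model H g v - quad_model H g v' \<ge> 0"
      using quad_model_full_step[OF sym r rp pos] pos \<alpha> step.hyps by simp
    then show ?thesis using step.IH False by linarith
  qed
  then show ?case using r' rp' small step.hyps by simp
qed

theorem proposition4p7:
  fixes H :: "real^'d^'d" and g \<xi> u :: "real^'d"
    and \<nu> L\<^sub>G \<Delta> \<omega>1 \<omega>2 :: real and stop :: stop_reason and T :: nat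
  assumes params: "0 < \<omega>1" "\<omega>1 < 1" "0 < \<omega>2"
    and symmetric: "transpose H = H"
    and bounds: "0 < \<nu>" "\<nu> \<le> L\<^sub>G"
    and sing: "singular_values H \<subseteq> {\<nu>..L\<^sub>G}"
    and radius: "0 < \<Delta>"
    and start: "norm \<xi> \<le> \<Delta> / 4" "(H *v \<xi>) \<bullet> g \<ge> 0"
    and run: "tCG_bg \<omega>1 \<omega>2 H g \<Delta> \<xi> u stop T"
    and stop: "stop = Boundary"
  shows "quad_model H g \<xi> - quad_model H g u \<ge> \<nu>\<^sup>2 * \<Delta>\<^sup>2 / (32 * L\<^sub>G)"
proof -
  have lower: "\<nu> * norm x \<le> norm (H *v x)" and norm_le: "norm (H *v x) \<le> L\<^sub>G * norm x" for x
    using singular_values_norm_bounds[OF sing] by auto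
  have upper: "x \<bullet> (H *v x) \<le> L\<^sub>G * (norm x)\<^sup>2" for x
    using norm_cauchy_schwarz[of x "H *v x"] mult_left_mono[OF norm_le[of x] norm_ge_zero[of x]]
    by (simp add: power2_eq_square algebra_simps)
  have L: "L\<^sub>G > 0" using bounds by simp
  obtain t v \<rho> p s v' where st: "tCG_bg_state \<omega>1 \<omega>2 H g \<Delta> \<xi> t v \<rho> p"
    and leave: "cg_leaves H \<Delta> v \<rho> p" and s: "s \<ge> 0" and v': "v' = v + s *\<^sub>R p" "norm v' = \<Delta> / 2"
    and bg: "boundary_gradient_step H g \<Delta> v' u"
    using run stop by (cases rule: tCG_bg.cases) auto
  have "norm \<xi> < \<Delta> / 2" using start radius by simp
  note inv = tCG_bg_state_invariant[OF st symmetric upper this]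
  then have r: "\<rho> = - (H *v v + g)" and rp: "\<rho> \<bullet> p = (norm \<rho>)\<^sup>2" and v: "norm v < \<Delta> / 2"
    by auto
  have leave': "p \<bullet> (H *v p) \<le> 0 \<or> norm (v + ((norm \<rho>)\<^sup>2 / (p \<bullet> (H *v p))) *\<^sub>R p) \<ge> \<Delta> / 2"
    using leave by (simp add: cg_leaves_def cg_step_length_def)
  have end_point: "norm (v + s *\<^sub>R p) = \<Delta> / 2" using v' by simp
  have v_v': "quad_model H g v' \<le> quad_model H g v"
    using quad_model_truncated_step[OF symmetric r rp v s end_point leave'] s v'(1)
    by (smt (verit) divide_nonneg_pos mult_nonneg_nonneg zero_le_power2)
  define r' where "r' = - (H *v v' + g)"
  \<comment> \<open>The gap left to the outer sphere is \<open>\<Delta> - \<Delta> / 2\<close>,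
    which yields the factor 1/4.\<close>
  have v'_u: "quad_model H g v' - quad_model H g u
      \<ge> min (\<Delta> * norm r' / 4) ((norm r')\<^sup>2 / (2 * L\<^sub>G))"
    using boundary_gradient_step_decrease[OF symmetric r'_def upper _ bg] v'(2) radius
    by (simp add: mult.commute)
  have u_v': "quad_model H g u \<le> quad_model H g v'"
    using v'_u radius L by (smt (verit) divide_nonneg_pos mult_nonneg_nonneg norm_ge_zero zero_le_power2)
  define B where "B = \<nu>\<^sup>2 * \<Delta>\<^sup>2 / (32 * L\<^sub>G)"
  \<comment> \<open>The threshold \<open>\<nu> * \<Delta> / 4\<close> gives equality here.\<close>
  have B_quad: "B \<le> y\<^sup>2 / (2 * L\<^sub>G)" if "\<nu> * \<Delta> / 4 \<le> y" for y
  proof -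
    have "(\<nu> * \<Delta> / 4)\<^sup>2 \<le> y\<^sup>2" using that bounds radius by (intro power_mono) auto
    then have "(\<nu> * \<Delta> / 4)\<^sup>2 / (2 * L\<^sub>G) \<le> y\<^sup>2 / (2 * L\<^sub>G)"
      using L by (intro divide_right_mono) auto
    then show ?thesis by (simp add: B_def power2_eq_square mult.assoc mult.left_commute)
  qed
  \<comment> \<open>The factor 1/8 is that of a truncated first step: a gap of at least
    \<open>\<Delta> / 4\<close>, halved. The bound uses
    \<open>\<nu> / L\<^sub>G \<le> 1\<close>.\<close>
  have B_lin: "B \<le> \<Delta> * y / 8" if "\<nu> * \<Delta> / 4 \<le> y" for y
  proof -
    have "B = \<nu> / L\<^sub>G * (\<Delta> * (\<nu> * \<Delta> / 4) / 8)"
      by (simp add: B_def power2_eq_square mult.commute mult.left_commute)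
    also have "\<dots> \<le> 1 * (\<Delta> * (\<nu> * \<Delta> / 4) / 8)"
      using bounds radius L by (intro mult_right_mono) auto
    also have "\<dots> \<le> \<Delta> * y / 8"
      using mult_left_mono[OF that, of \<Delta>] radius by linarith
    finally show ?thesis .
  qed
  have "B \<le> quad_model H g \<xi> - quad_model H g u"
  proof (cases "norm g \<le> \<nu> * \<Delta> / 4")
    case True
    have "\<nu> * (\<Delta> / 2) \<le> norm (H *v v')" using lower[of v'] v'(2) by simp
    moreover have "norm (H *v v') \<le> norm r' + norm g"
      using norm_triangle_ineq4[of "H *v v' + g" g]
      by (simp only: r'_def norm_minus_cancel add_diff_cancel_right')
    ultimately have r'_large: "\<nu> * \<Delta> / 4 \<le> norm r'" using True by simp
    \<comment> \<open>Needed to pass from the factor 1/8 in \<open>B_lin\<close> to 1/4.\<close>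
    have "0 \<le> \<Delta> * norm r'" using radius by simp
    then have "B \<le> min (\<Delta> * norm r' / 4) ((norm r')\<^sup>2 / (2 * L\<^sub>G))"
      using B_quad[OF r'_large] B_lin[OF r'_large] by simp
    moreover have "quad_model H g v \<le> quad_model H g \<xi>"
    proof (cases "v = \<xi>")
      case False
      moreover have "0 \<le> (norm (H *v \<xi> + g))\<^sup>2 / (2 * L\<^sub>G)" using L by simp
      ultimately show ?thesis using inv by linarith
    qed simp
    ultimately show ?thesis using v'_u v_v' by linarith
  next
    case False
    \<comment> \<open>Expanding the square, the cross term is nonnegative by the assumption on
      \<open>\<xi>\<close>.\<close>
    have "(norm g)\<^sup>2 \<le> (norm (H *v \<xi> + g))\<^sup>2"
      using start(2) by (simp add: power2_norm_eq_inner inner_add_left inner_add_right inner_commute)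
    then have "norm g \<le> norm (H *v \<xi> + g)" by (rule power2_le_imp_le) simp
    with False have r0_large: "\<nu> * \<Delta> / 4 \<le> norm (H *v \<xi> + g)" by simp
    have "B \<le> quad_model H g \<xi> - quad_model H g v'"
    \<comment> \<open>Either the step to \<open>v'\<close> is a truncated gradient step from
      \<open>\<xi>\<close>, or the invariant already holds the decrease of a full one.\<close>
    proof (cases "v = \<xi> \<and> p = \<rho>")
      case True
      then have "quad_model H g \<xi> - quad_model H g v' \<ge> (\<Delta> / 2 - norm \<xi>) * norm \<rho> / 2"
        using quad_model_truncated_gradient_step[OF symmetric r v s] end_point leave' v'(1)
        by simp
      moreover have "(\<Delta> / 2 - norm \<xi>) * norm \<rho> \<ge> \<Delta> / 4 * norm \<rho>"
        using start(1) by (intro mult_right_mono) auto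
      moreover have "\<nu> * \<Delta> / 4 \<le> norm \<rho>"
        using r0_large r True by (metis norm_minus_cancel)
      ultimately show ?thesis using B_lin[of "norm \<rho>"] by linarith
    next
      case False
      then show ?thesis using inv v_v' B_quad[OF r0_large] by linarith
    qed
    then show ?thesis using u_v' by linarith
  qed
  then show ?thesis by (simp add: B_def)
qed

end
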